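(* Let $(E,h,\Phi,\mathcal{U},\mathcal{Q},\kappa)$ be a tt*-bundle (CV-structure) on a complex manifold $M$, with $h$ positive definite, let $r=\mathrm{rank}\,E$, and fix any $p\in M$. Then: (1) If $r=2l+1$, then $0$ is an eigenvalue of $\mathcal{Q}(p)$, and there exist $l=[r/2]$ non-negative real numbers $\lambda_1,\dots,\lambda_l$ such that the matrix of $\mathcal{Q}(p)$ can be diagonalized to $$\mathrm{diag}(\lambda_1,\dots,\lambda_l,0,-\lambda_1,\dots,-\lambda_l).$$ (2) If $r=2l$, there exist $l=r/2$ non-negative real numbers $\lambda_1,\dots,\lambda_l$ such that the matrix of $\mathcal{Q}(p)$ can be diagonalized to $$\mathrm{diag}(\lambda_1,\dots,\lambda_l,-\lambda_1,\dots,-\lambda_l).$$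
   Context: Let $E$ be a holomorphic vector bundle on a complex manifold $M$ with Hermitian metric $h$ (positive definite throughout). Let $H$ be the underlying $C^\infty$ bundle and $D=D'+\overline\partial$ the Chern connection of $h$. $P^\dagger$ denotes the $h$-adjoint of $P$, and $D'(P)=[D',P]$. A Higgs field is an $\mathcal{O}_M$-linear morphism $\Phi:E\to\Omega^1_M\otimes E$ with $\Phi\wedge\Phi=0$. $(E,h,\Phi)$ is a harmonic Higgs bundle if $D'+\overline\partial+\Phi+\Phi^\dagger$ is an integrable (flat) connection on $H$. An integrable harmonic Higgs bundle $(E,h,\Phi,\mathcal{U},\mathcal{Q})$ is a harmonic Higgs bundle with two $C^\infty$ endomorphisms $\mathcal{U},\mathcal{Q}$ of $H$ such that $$\overline\partial(\mathcal{U})=0,\quad \mathcal{Q}^\dagger=\mathcal{Q},\quad [\Phi,\mathcal{U}]=0,\quad D'(\mathcal{U})-[\Phi,\mathcal{Q}]+\Phi=0,\quad D'(\mathcal{Q})+[\Phi,\mathcal{U}^\dagger]=0.$$ A real structure is an antilinear isomorphism $\kappa:H\to H$ with $\kappa^2=\mathrm{Id}$, $h(\kappa\cdot,\kappa\cdot)=\overline{h(\cdot,\cdot)}$ and $D(\kappa)=0$. Put $g(X,Y)=h(X,\kappa Y)$, a symmetric nondegenerate bilinear form, and let ${}^*$ denote the adjoint with respect to $g$. A tt*-bundle (CV-structure) is an integrable harmonic Higgs bundle together with a real structure $\kappa$ such that $\mathcal{U}^*=\mathcal{U}$ and $\mathcal{Q}^*+\mathcal{Q}=0$; the latter is equivalent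 to $\mathcal{Q}=-\kappa\mathcal{Q}\kappa$. *)

theory Defs
  imports "HOL-Analysis.Analysis" "Jordan_Normal_Form.Matrix"
begin

section \<open>Smooth and holomorphic functions on open subsets of complex coordinate space\<close>

text \<open>The coordinate space of dimension \<open>n\<close> (possibly \<open>0\<close>) is realised inside
  \<open>nat \<Rightarrow> complex\<close> with the product topology, so that \<open>n\<close> stays a term parameter.\<close>

definition cspace :: "nat \<Rightarrow> (nat \<Rightarrow> complex) set" where
  "cspace n = {z. \<forall>i\<ge>n. z i = 0}"

definition slice :: "nat \<Rightarrow> complex \<Rightarrow> ((nat \<Rightarrow> complex) \<Rightarrow> complex) \<Rightarrow> (nat \<Rightarrow> complex) \<Rightarrow> real \<Rightarrow> complex"
  where "slice i w f z = (\<lambda>t. f (z(i := z i + of_real t * w)))"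

text \<open>\<open>pderiv_dir i 1\<close> and \<open>pderiv_dir i \<i>\<close> are the partial derivatives with respect to the real and
  the imaginary part of the \<open>i\<close>-th coordinate.\<close>

definition pderiv_dir :: "nat \<Rightarrow> complex \<Rightarrow> ((nat \<Rightarrow> complex) \<Rightarrow> complex) \<Rightarrow> (nat \<Rightarrow> complex) \<Rightarrow> complex"
  where "pderiv_dir i w f z = vector_derivative (slice i w f z) (at 0)"

fun Ck_on :: "nat \<Rightarrow> nat \<Rightarrow> (nat \<Rightarrow> complex) set \<Rightarrow> ((nat \<Rightarrow> complex) \<Rightarrow> complex) \<Rightarrow> bool" where
  "Ck_on n 0 W f \<longleftrightarrow> continuous_on W f"
| "Ck_on n (Suc k) W f \<longleftrightarrow> continuous_on W f \<and>
     (\<forall>i<n. \<forall>w\<in>{1, \<i>}. (\<forall>z\<in>W. slice i w f z differentiable (at 0)) \<and> Ck_on n k W (pderiv_dir i w f))"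

definition Cinf_on :: "nat \<Rightarrow> (nat \<Rightarrow> complex) set \<Rightarrow> ((nat \<Rightarrow> complex) \<Rightarrow> complex) \<Rightarrow> bool" where
  "Cinf_on n W f \<longleftrightarrow> (\<forall>k. Ck_on n k W f)"

definition dz :: "nat \<Rightarrow> ((nat \<Rightarrow> complex) \<Rightarrow> complex) \<Rightarrow> (nat \<Rightarrow> complex) \<Rightarrow> complex" where
  "dz i f z = (pderiv_dir i 1 f z - \<i> * pderiv_dir i \<i> f z) / 2"

definition dzbar :: "nat \<Rightarrow> ((nat \<Rightarrow> complex) \<Rightarrow> complex) \<Rightarrow> (nat \<Rightarrow> complex) \<Rightarrow> complex" where
  "dzbar i f z = (pderiv_dir i 1 f z + \<i> * pderiv_dir i \<i> f z) / 2"

definition hol_on :: "nat \<Rightarrow> (nat \<Rightarrow> complex) set \<Rightarrow> ((nat \<Rightarrow> complex) \<Rightarrow> complex) \<Rightarrow> bool" where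
  "hol_on n W f \<longleftrightarrow> Cinf_on n W f \<and> (\<forall>i<n. \<forall>z\<in>W. dzbar i f z = 0)"


section \<open>Complex manifolds\<close>

type_synonym 'm chart = "'m set \<times> ('m \<Rightarrow> nat \<Rightarrow> complex)"

text \<open>Complexified tangent vectors at a point are represented as derivations, i.e. as functionals on
  functions. They are given the value \<open>0\<close> on functions that are not smooth near the point.\<close>

type_synonym 'm tvec = "('m \<Rightarrow> complex) \<Rightarrow> complex"

definition conj_tvec :: "'m tvec \<Rightarrow> 'm tvec" where
  "conj_tvec v = (\<lambda>f. cnj (v (\<lambda>q. cnj (f q))))"

locale complex_manifold =
  fixes n :: nat
    and A :: "('m :: {t2_space, second_countable_topology}) chart set"
  assumes chart_open: "(V, x) \<in> A \<Longrightarrow> open V"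
    and chart_image_open: "(V, x) \<in> A \<Longrightarrow> openin (top_of_set (cspace n)) (x ` V)"
    and chart_homeo: "(V, x) \<in> A \<Longrightarrow> \<exists>y. homeomorphism V (x ` V) x y"
    and chart_cover: "\<exists>(V, x)\<in>A. p \<in> V"
    and chart_compat: "(V, x) \<in> A \<Longrightarrow> (V', y) \<in> A \<Longrightarrow> j < n \<Longrightarrow>
          hol_on n (x ` (V \<inter> V')) (\<lambda>z. y (inv_into V x z) j)"
begin

definition smooth_fun :: "'m set \<Rightarrow> ('m \<Rightarrow> complex) \<Rightarrow> bool" where
  "smooth_fun W f \<longleftrightarrow> (\<forall>(V, x)\<in>A. Cinf_on n (x ` (V \<inter> W)) (f \<circ> inv_into V x))"

definition hol_fun :: "'m set \<Rightarrow> ('m \<Rightarrow> complex) \<Rightarrow> bool" where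
  "hol_fun W f \<longleftrightarrow> (\<forall>(V, x)\<in>A. hol_on n (x ` (V \<inter> W)) (f \<circ> inv_into V x))"

definition smooth_fun_at :: "'m \<Rightarrow> ('m \<Rightarrow> complex) \<Rightarrow> bool" where
  "smooth_fun_at p f \<longleftrightarrow> (\<exists>W. open W \<and> p \<in> W \<and> smooth_fun W f)"

definition ddz :: "'m chart \<Rightarrow> nat \<Rightarrow> 'm \<Rightarrow> 'm tvec" where
  "ddz c i p = (\<lambda>f. if smooth_fun_at p f then dz i (f \<circ> inv_into (fst c) (snd c)) (snd c p) else 0)"

definition ddzbar :: "'m chart \<Rightarrow> nat \<Rightarrow> 'm \<Rightarrow> 'm tvec" where
  "ddzbar c i p = (\<lambda>f. if smooth_fun_at p f then dzbar i (f \<circ> inv_into (fst c) (snd c)) (snd c p) else 0)"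

text \<open>\<open>T10 p\<close>, \<open>T01 p\<close> and \<open>TC p\<close> are the fibres at \<open>p\<close> of the holomorphic, the antiholomorphic and the
  whole complexified tangent bundle.\<close>

definition T10 :: "'m \<Rightarrow> 'm tvec set" where
  "T10 p = {v. \<exists>(V, x)\<in>A. p \<in> V \<and> (\<exists>a. v = (\<lambda>f. \<Sum>i<n. a i * ddz (V, x) i p f))}"

definition T01 :: "'m \<Rightarrow> 'm tvec set" where
  "T01 p = {v. \<exists>(V, x)\<in>A. p \<in> V \<and> (\<exists>a. v = (\<lambda>f. \<Sum>i<n. a i * ddzbar (V, x) i p f))}"

definition TC :: "'m \<Rightarrow> 'm tvec set" where
  "TC p = {\<lambda>f. u f + w f | u w. u \<in> T10 p \<and> w \<in> T01 p}"

definition smooth_vfield :: "'m set \<Rightarrow> ('m \<Rightarrow> 'm tvec) \<Rightarrow> bool" where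
  "smooth_vfield W \<xi> \<longleftrightarrow> (\<forall>q\<in>W. \<xi> q \<in> TC q) \<and>
     (\<forall>W' f. open W' \<and> W' \<subseteq> W \<and> smooth_fun W' f \<longrightarrow> smooth_fun W' (\<lambda>q. \<xi> q f))"

definition hol_vfield :: "'m set \<Rightarrow> ('m \<Rightarrow> 'm tvec) \<Rightarrow> bool" where
  "hol_vfield W \<xi> \<longleftrightarrow> (\<forall>q\<in>W. \<xi> q \<in> T10 q) \<and>
     (\<forall>W' f. open W' \<and> W' \<subseteq> W \<and> hol_fun W' f \<longrightarrow> hol_fun W' (\<lambda>q. \<xi> q f))"

definition lie_bracket :: "('m \<Rightarrow> 'm tvec) \<Rightarrow> ('m \<Rightarrow> 'm tvec) \<Rightarrow> 'm \<Rightarrow> 'm tvec" where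
  "lie_bracket \<xi> \<eta> p =
     (\<lambda>f. if smooth_fun_at p f then \<xi> p (\<lambda>q. \<eta> q f) - \<eta> p (\<lambda>q. \<xi> q f) else 0)"

end


section \<open>Linear algebra in a fibre\<close>

locale complex_vector_space = vector_space scale
  for scale :: "complex \<Rightarrow> 'v :: ab_group_add \<Rightarrow> 'v"
begin

definition indexed_basis :: "nat \<Rightarrow> 'v set \<Rightarrow> (nat \<Rightarrow> 'v) \<Rightarrow> bool" where
  "indexed_basis r S b \<longleftrightarrow>
     inj_on b {..<r} \<and> independent (b ` {..<r}) \<and> span (b ` {..<r}) = S"

definition coord :: "nat \<Rightarrow> (nat \<Rightarrow> 'v) \<Rightarrow> 'v \<Rightarrow> nat \<Rightarrow> complex" where
  "coord r b v i = representation (b ` {..<r}) v (b i)"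

definition endo_on :: "'v set \<Rightarrow> ('v \<Rightarrow> 'v) \<Rightarrow> bool" where
  "endo_on S P \<longleftrightarrow> (\<forall>u\<in>S. P u \<in> S) \<and> (\<forall>u\<in>S. \<forall>w\<in>S. P (u + w) = P u + P w) \<and>
     (\<forall>a. \<forall>u\<in>S. P (scale a u) = scale a (P u))"

definition matrix_of :: "nat \<Rightarrow> (nat \<Rightarrow> 'v) \<Rightarrow> ('v \<Rightarrow> 'v) \<Rightarrow> complex mat" where
  "matrix_of r b P = Matrix.mat r r (\<lambda>(i, j). coord r b (P (b j)) i)"

definition is_eigenvalue_on :: "'v set \<Rightarrow> ('v \<Rightarrow> 'v) \<Rightarrow> complex \<Rightarrow> bool" where
  "is_eigenvalue_on S P a \<longleftrightarrow> (\<exists>u\<in>S. u \<noteq> 0 \<and> P u = scale a u)"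

end

text \<open>The adjoint of \<open>P\<close> with respect to a nondegenerate (bilinear or sesquilinear) form \<open>B\<close> on \<open>S\<close>.\<close>

definition form_adjoint :: "'v set \<Rightarrow> ('v \<Rightarrow> 'v \<Rightarrow> complex) \<Rightarrow> ('v \<Rightarrow> 'v) \<Rightarrow> 'v \<Rightarrow> 'v" where
  "form_adjoint S B P = (\<lambda>w. THE w'. w' \<in> S \<and> (\<forall>u\<in>S. B (P u) w = B u w'))"

definition diag_of_list :: "'a :: zero list \<Rightarrow> 'a mat" where
  "diag_of_list ds = mat_diag (length ds) (\<lambda>i. ds ! i)"


section \<open>Holomorphic vector bundles\<close>

text \<open>The fibres \<open>E p\<close> are subspaces of one ambient complex vector space; this is no restriction, as any
  family of vector spaces embeds into its direct sum. The holomorphic structure is given by a family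
  \<open>F\<close> of local frames with holomorphic transition functions, whose domains cover the manifold.\<close>

locale holomorphic_vector_bundle = complex_manifold n A + complex_vector_space scale
  for n :: nat
    and A :: "('m :: {t2_space, second_countable_topology}) chart set"
    and scale :: "complex \<Rightarrow> 'v :: ab_group_add \<Rightarrow> 'v" (infixr "\<odot>" 75) +
  fixes r :: nat
    and E :: "'m \<Rightarrow> 'v set"
    and F :: "('m set \<times> (nat \<Rightarrow> 'm \<Rightarrow> 'v)) set"
  assumes frame_open: "(U, e) \<in> F \<Longrightarrow> open U"
    and frame_cover: "\<exists>(U, e)\<in>F. p \<in> U"
    and frame_basis: "(U, e) \<in> F \<Longrightarrow> p \<in> U \<Longrightarrow> indexed_basis r (E p) (\<lambda>j. e j p)"
    and frame_transition: "(U, e) \<in> F \<Longrightarrow> (U', e') \<in> F \<Longrightarrow> i < r \<Longrightarrow> j < r \<Longrightarrow>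
          hol_fun (U \<inter> U') (\<lambda>q. coord r (\<lambda>k. e k q) (e' j q) i)"
begin

definition smooth_section :: "'m set \<Rightarrow> ('m \<Rightarrow> 'v) \<Rightarrow> bool" where
  "smooth_section W s \<longleftrightarrow> (\<forall>q\<in>W. s q \<in> E q) \<and>
     (\<forall>(U, e)\<in>F. \<forall>j<r. smooth_fun (U \<inter> W) (\<lambda>q. coord r (\<lambda>k. e k q) (s q) j))"

definition hol_section :: "'m set \<Rightarrow> ('m \<Rightarrow> 'v) \<Rightarrow> bool" where
  "hol_section W s \<longleftrightarrow> (\<forall>q\<in>W. s q \<in> E q) \<and>
     (\<forall>(U, e)\<in>F. \<forall>j<r. hol_fun (U \<inter> W) (\<lambda>q. coord r (\<lambda>k. e k q) (s q) j))"

definition smooth_section_at :: "'m \<Rightarrow> ('m \<Rightarrow> 'v) \<Rightarrow> bool" where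
  "smooth_section_at p s \<longleftrightarrow> (\<exists>W. open W \<and> p \<in> W \<and> smooth_section W s)"

definition smooth_endo :: "('m \<Rightarrow> 'v \<Rightarrow> 'v) \<Rightarrow> bool" where
  "smooth_endo P \<longleftrightarrow> (\<forall>p. endo_on (E p) (P p)) \<and>
     (\<forall>W s. open W \<and> smooth_section W s \<longrightarrow> smooth_section W (\<lambda>q. P q (s q)))"

text \<open>The Dolbeault operator of the bundle, for \<open>v \<in> T01 p\<close>: differentiate the coefficients in a
  holomorphic frame near \<open>p\<close>. The result does not depend on the frame because the transition
  functions are holomorphic.\<close>

definition dbar :: "'m \<Rightarrow> 'm tvec \<Rightarrow> ('m \<Rightarrow> 'v) \<Rightarrow> 'v" where
  "dbar p v s = (let e = snd (SOME (U, e). (U, e) \<in> F \<and> p \<in> U) in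
     \<Sum>j<r. v (\<lambda>q. coord r (\<lambda>k. e k q) (s q) j) \<odot> e j p)"

text \<open>A connection on the underlying smooth bundle, extended complex-linearly to complexified tangent
  vectors: \<open>D p v s\<close> is the covariant derivative at \<open>p\<close> of the local section \<open>s\<close> in direction \<open>v\<close>.\<close>

definition is_connection :: "('m \<Rightarrow> 'm tvec \<Rightarrow> ('m \<Rightarrow> 'v) \<Rightarrow> 'v) \<Rightarrow> bool" where
  "is_connection D \<longleftrightarrow>
     (\<forall>p. \<forall>v\<in>TC p. \<forall>s. smooth_section_at p s \<longrightarrow> D p v s \<in> E p) \<and>
     (\<forall>p. \<forall>v\<in>TC p. \<forall>s t. smooth_section_at p s \<and> smooth_section_at p t \<and>
        (\<exists>W. open W \<and> p \<in> W \<and> (\<forall>q\<in>W. s q = t q)) \<longrightarrow> D p v s = D p v t) \<and>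
     (\<forall>p. \<forall>v\<in>TC p. \<forall>w\<in>TC p. \<forall>a b s. smooth_section_at p s \<longrightarrow>
        D p (\<lambda>f. a * v f + b * w f) s = a \<odot> D p v s + b \<odot> D p w s) \<and>
     (\<forall>p. \<forall>v\<in>TC p. \<forall>s t. smooth_section_at p s \<and> smooth_section_at p t \<longrightarrow>
        D p v (\<lambda>q. s q + t q) = D p v s + D p v t) \<and>
     (\<forall>p. \<forall>v\<in>TC p. \<forall>f s. smooth_fun_at p f \<and> smooth_section_at p s \<longrightarrow>
        D p v (\<lambda>q. f q \<odot> s q) = v f \<odot> s p + f p \<odot> D p v s) \<and>
     (\<forall>W \<xi> s. open W \<and> smooth_vfield W \<xi> \<and> smooth_section W s \<longrightarrow>
        smooth_section W (\<lambda>q. D q (\<xi> q) s))"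

definition is_flat :: "('m \<Rightarrow> 'm tvec \<Rightarrow> ('m \<Rightarrow> 'v) \<Rightarrow> 'v) \<Rightarrow> bool" where
  "is_flat D \<longleftrightarrow>
     (\<forall>W \<xi> \<eta> s. open W \<and> smooth_vfield W \<xi> \<and> smooth_vfield W \<eta> \<and> smooth_section W s \<longrightarrow>
        (\<forall>p\<in>W. D p (\<xi> p) (\<lambda>q. D q (\<eta> q) s) - D p (\<eta> p) (\<lambda>q. D q (\<xi> q) s)
             = D p (lie_bracket \<xi> \<eta> p) s))"

text \<open>\<open>[D, P]\<close> evaluated on the tangent vector \<open>v\<close> and the local section \<open>s\<close>.\<close>

definition deriv_endo ::
  "('m \<Rightarrow> 'm tvec \<Rightarrow> ('m \<Rightarrow> 'v) \<Rightarrow> 'v) \<Rightarrow> ('m \<Rightarrow> 'v \<Rightarrow> 'v) \<Rightarrow> 'm \<Rightarrow> 'm tvec \<Rightarrow> ('m \<Rightarrow> 'v) \<Rightarrow> 'v" where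
  "deriv_endo D P p v s = D p v (\<lambda>q. P q (s q)) - P p (D p v s)"

end


section \<open>Hermitian metrics and harmonic Higgs bundles\<close>

text \<open>Hermitian forms are linear in the first and antilinear in the second argument.\<close>

locale hermitian_holomorphic_bundle = holomorphic_vector_bundle n A scale r E F
  for n :: nat
    and A :: "('m :: {t2_space, second_countable_topology}) chart set"
    and scale :: "complex \<Rightarrow> 'v :: ab_group_add \<Rightarrow> 'v" (infixr "\<odot>" 75)
    and r E F +
  fixes h :: "'m \<Rightarrow> 'v \<Rightarrow> 'v \<Rightarrow> complex"
  assumes h_add: "u \<in> E p \<Longrightarrow> u' \<in> E p \<Longrightarrow> w \<in> E p \<Longrightarrow> h p (u + u') w = h p u w + h p u' w"
    and h_scale: "u \<in> E p \<Longrightarrow> w \<in> E p \<Longrightarrow> h p (a \<odot> u) w = a * h p u w"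
    and h_sym: "u \<in> E p \<Longrightarrow> w \<in> E p \<Longrightarrow> h p w u = cnj (h p u w)"
    and h_pos: "u \<in> E p \<Longrightarrow> u \<noteq> 0 \<Longrightarrow> 0 < Re (h p u u)"
    and h_smooth: "open W \<Longrightarrow> smooth_section W s \<Longrightarrow> smooth_section W t \<Longrightarrow>
          smooth_fun W (\<lambda>q. h q (s q) (t q))"
begin

definition hadj :: "'m \<Rightarrow> ('v \<Rightarrow> 'v) \<Rightarrow> 'v \<Rightarrow> 'v" where
  "hadj p P = form_adjoint (E p) (h p) P"

text \<open>The connection that is compatible with \<open>h\<close> and has \<open>dbar\<close> as its (0,1)-part. The operator \<open>D'\<close> is
  its restriction to \<open>T10\<close>. Since tangent vectors may be complex, compatibility with \<open>h\<close> involves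
  the conjugate tangent vector in the second slot.\<close>

definition is_chern_connection :: "('m \<Rightarrow> 'm tvec \<Rightarrow> ('m \<Rightarrow> 'v) \<Rightarrow> 'v) \<Rightarrow> bool" where
  "is_chern_connection D \<longleftrightarrow> is_connection D \<and>
     (\<forall>p. \<forall>v\<in>T01 p. \<forall>s. smooth_section_at p s \<longrightarrow> D p v s = dbar p v s) \<and>
     (\<forall>p. \<forall>v\<in>TC p. \<forall>s t. smooth_section_at p s \<and> smooth_section_at p t \<longrightarrow>
        v (\<lambda>q. h q (s q) (t q)) = h p (D p v s) (t p) + h p (s p) (D p (conj_tvec v) t))"

text \<open>A Higgs field is an End(E)-valued holomorphic (1,0)-form: \<open>\<Phi> p v\<close> is its value on the tangent
  vector \<open>v\<close> at \<open>p\<close>; it vanishes on \<open>T01\<close>. Morphisms of sheaves of sections that are linear over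
  holomorphic functions are the same as holomorphic, fibrewise linear maps.\<close>

definition is_higgs_field :: "('m \<Rightarrow> 'm tvec \<Rightarrow> 'v \<Rightarrow> 'v) \<Rightarrow> bool" where
  "is_higgs_field \<Phi> \<longleftrightarrow>
     (\<forall>p. \<forall>v\<in>TC p. endo_on (E p) (\<Phi> p v)) \<and>
     (\<forall>p. \<forall>v\<in>TC p. \<forall>w\<in>TC p. \<forall>a b. \<forall>u\<in>E p.
        \<Phi> p (\<lambda>f. a * v f + b * w f) u = a \<odot> \<Phi> p v u + b \<odot> \<Phi> p w u) \<and>
     (\<forall>p. \<forall>v\<in>T01 p. \<forall>u\<in>E p. \<Phi> p v u = 0) \<and>
     (\<forall>W \<xi> s. open W \<and> hol_vfield W \<xi> \<and> hol_section W s \<longrightarrow>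
        hol_section W (\<lambda>q. \<Phi> q (\<xi> q) (s q))) \<and>
     (\<forall>p. \<forall>v\<in>TC p. \<forall>w\<in>TC p. \<forall>u\<in>E p. \<Phi> p v (\<Phi> p w u) - \<Phi> p w (\<Phi> p v u) = 0)"

text \<open>The adjoint form, of type (0,1): in coordinates, the adjoint of \<open>\<Phi>\<^sub>i dz\<^sub>i\<close> is the adjoint
  endomorphism of \<open>\<Phi>\<^sub>i\<close> times the conjugate of \<open>dz\<^sub>i\<close>.\<close>

definition adj_form :: "('m \<Rightarrow> 'm tvec \<Rightarrow> 'v \<Rightarrow> 'v) \<Rightarrow> 'm \<Rightarrow> 'm tvec \<Rightarrow> 'v \<Rightarrow> 'v" where
  "adj_form \<Phi> p v = hadj p (\<Phi> p (conj_tvec v))"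

end

locale harmonic_higgs_bundle = hermitian_holomorphic_bundle n A scale r E F h
  for n :: nat
    and A :: "('m :: {t2_space, second_countable_topology}) chart set"
    and scale :: "complex \<Rightarrow> 'v :: ab_group_add \<Rightarrow> 'v" (infixr "\<odot>" 75)
    and r E F h +
  fixes D :: "'m \<Rightarrow> 'm tvec \<Rightarrow> ('m \<Rightarrow> 'v) \<Rightarrow> 'v"
    and \<Phi> :: "'m \<Rightarrow> 'm tvec \<Rightarrow> 'v \<Rightarrow> 'v"
  assumes chern: "is_chern_connection D"
    and higgs: "is_higgs_field \<Phi>"
    and flat: "is_flat (\<lambda>p v s. D p v s + \<Phi> p v (s p) + adj_form \<Phi> p v (s p))"

locale integrable_harmonic_higgs_bundle = harmonic_higgs_bundle n A scale r E F h D \<Phi>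
  for n :: nat
    and A :: "('m :: {t2_space, second_countable_topology}) chart set"
    and scale :: "complex \<Rightarrow> 'v :: ab_group_add \<Rightarrow> 'v" (infixr "\<odot>" 75)
    and r E F h D \<Phi> +
  fixes \<U> \<Q> :: "'m \<Rightarrow> 'v \<Rightarrow> 'v"
  assumes U_smooth: "smooth_endo \<U>"
    and Q_smooth: "smooth_endo \<Q>"
    and dbar_U: "v \<in> T01 p \<Longrightarrow> smooth_section_at p s \<Longrightarrow> deriv_endo dbar \<U> p v s = 0"
    and Q_selfadjoint: "u \<in> E p \<Longrightarrow> hadj p (\<Q> p) u = \<Q> p u"
    and Phi_U: "v \<in> T10 p \<Longrightarrow> u \<in> E p \<Longrightarrow> \<Phi> p v (\<U> p u) - \<U> p (\<Phi> p v u) = 0"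
    and D_U: "v \<in> T10 p \<Longrightarrow> smooth_section_at p s \<Longrightarrow>
          deriv_endo D \<U> p v s - (\<Phi> p v (\<Q> p (s p)) - \<Q> p (\<Phi> p v (s p))) + \<Phi> p v (s p) = 0"
    and D_Q: "v \<in> T10 p \<Longrightarrow> smooth_section_at p s \<Longrightarrow>
          deriv_endo D \<Q> p v s + (\<Phi> p v (hadj p (\<U> p) (s p)) - hadj p (\<U> p) (\<Phi> p v (s p))) = 0"


section \<open>tt*-bundles (CV-structures)\<close>

text \<open>The condition \<open>D(\<kappa>) = 0\<close> says \<open>D\<^sub>X (\<kappa> s) = \<kappa> (D\<^sub>X s)\<close> for real tangent vectors \<open>X\<close>; as \<open>\<kappa>\<close> is
  antilinear, the complexified version has the conjugate vector on the right. The form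
  \<open>\<lambda>x y. h p x (\<kappa> p y)\<close> is the symmetric bilinear form \<open>g\<close>.\<close>

locale tt_star_bundle = integrable_harmonic_higgs_bundle n A scale r E F h D \<Phi> \<U> \<Q>
  for n :: nat
    and A :: "('m :: {t2_space, second_countable_topology}) chart set"
    and scale :: "complex \<Rightarrow> 'v :: ab_group_add \<Rightarrow> 'v" (infixr "\<odot>" 75)
    and r E F h D \<Phi> \<U> \<Q> +
  fixes \<kappa> :: "'m \<Rightarrow> 'v \<Rightarrow> 'v"
  assumes kappa_closed: "u \<in> E p \<Longrightarrow> \<kappa> p u \<in> E p"
    and kappa_add: "u \<in> E p \<Longrightarrow> w \<in> E p \<Longrightarrow> \<kappa> p (u + w) = \<kappa> p u + \<kappa> p w"
    and kappa_scale: "u \<in> E p \<Longrightarrow> \<kappa> p (a \<odot> u) = cnj a \<odot> \<kappa> p u"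
    and kappa_invol: "u \<in> E p \<Longrightarrow> \<kappa> p (\<kappa> p u) = u"
    and kappa_smooth: "open W \<Longrightarrow> smooth_section W s \<Longrightarrow> smooth_section W (\<lambda>q. \<kappa> q (s q))"
    and kappa_h: "u \<in> E p \<Longrightarrow> w \<in> E p \<Longrightarrow> h p (\<kappa> p u) (\<kappa> p w) = cnj (h p u w)"
    and kappa_parallel: "v \<in> TC p \<Longrightarrow> smooth_section_at p s \<Longrightarrow>
          D p v (\<lambda>q. \<kappa> q (s q)) = \<kappa> p (D p (conj_tvec v) s)"
    and U_g_selfadjoint: "u \<in> E p \<Longrightarrow>
          form_adjoint (E p) (\<lambda>x y. h p x (\<kappa> p y)) (\<U> p) u = \<U> p u"
    and Q_g_skew: "u \<in> E p \<Longrightarrow>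
          form_adjoint (E p) (\<lambda>x y. h p x (\<kappa> p y)) (\<Q> p) u + \<Q> p u = 0"

end

theory Submission
  imports Defs "Jordan_Normal_Form.Char_Poly"
begin

text \<open>At a point \<open>p\<close> the endomorphism \<open>\<Q>\<close> is self-adjoint for \<open>h\<close>, and comparing the two adjoint
  conditions gives \<open>\<Q> \<kappa> = - \<kappa> \<Q>\<close>. Hence the eigenvalues are real, and \<open>\<kappa>\<close> maps an eigenvector \<open>u\<close> for
  \<open>a \<noteq> 0\<close> to an eigenvector for \<open>- a\<close> that is orthogonal to \<open>u\<close>. Splitting off such pairs
  reduces the dimension by two while preserving all hypotheses on the orthogonal complement; once no
  nonzero eigenvalue is left, \<open>\<Q>\<close> vanishes on what remains.\<close>

section \<open>Coordinates, change of basis and existence of eigenvectors\<close>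

context complex_vector_space
begin

lemma endo_on_sum:
  assumes "endo_on S P" "subspace S" "finite K" "\<And>k. k \<in> K \<Longrightarrow> x k \<in> S"
  shows "P (\<Sum>k\<in>K. scale (a k) (x k)) = (\<Sum>k\<in>K. scale (a k) (P (x k)))"
  using assms(3,4)
proof (induction K rule: finite_induct)
  case empty
  \<comment> \<open>The empty sum needs \<open>P 0 = 0\<close>, which \<open>endo_on\<close> yields
    through homogeneity with the scalar 0.\<close>
  have "P (scale 0 0) = scale 0 (P 0)"
    using assms(1,2) by (metis endo_on_def subspace_0)
  then show ?case by simp
next
  case (insert k K)
  have "(\<Sum>k\<in>K. scale (a k) (x k)) \<in> S"
    using insert.prems by (intro subspace_sum subspace_scale assms(2)) auto
  then show ?case
    using assms(1,2) insert by (simp add: endo_on_def subspace_scale)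
qed

lemma indexed_basis_in:
  assumes "indexed_basis r S b" "i < r"
  shows "b i \<in> S"
  using assms unfolding indexed_basis_def by (metis imageI lessThan_iff span_base)

lemma indexed_basis_subspace:
  assumes "indexed_basis r S b"
  shows "subspace S"
  using assms unfolding indexed_basis_def by (metis subspace_span)

lemma coord_expand:
  assumes "indexed_basis r S b" "x \<in> S"
  shows "(\<Sum>i<r. scale (coord r b x i) (b i)) = x"
proof -
  have "(\<Sum>v\<in>b ` {..<r}. scale (representation (b ` {..<r}) x v) v) = x"
    using assms unfolding indexed_basis_def by (intro sum_representation_eq) auto
  then show ?thesis
    using assms(1) unfolding indexed_basis_def coord_def by (simp add: sum.reindex)
qed

lemma coord_basis:
  assumes "indexed_basis r S b" "i < r" "j < r"
  shows "coord r b (b j) i = (if i = j then 1 else 0)"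
  using assms unfolding indexed_basis_def coord_def
  by (auto simp: representation_basis inj_on_def)

lemma coord_scale:
  assumes "indexed_basis r S b" "x \<in> S"
  shows "coord r b (scale a x) i = a * coord r b x i"
  using assms unfolding indexed_basis_def coord_def
  by (metis representation_scale)

lemma coord_sum:
  assumes b: "indexed_basis r S b" and "finite K" "\<And>k. k \<in> K \<Longrightarrow> x k \<in> S"
  shows "coord r b (\<Sum>k\<in>K. x k) i = (\<Sum>k\<in>K. coord r b (x k) i)"
  using assms unfolding indexed_basis_def coord_def
  by (subst representation_sum) auto

text \<open>Expand \<open>x\<close> in \<open>c\<close> and use linearity. Keeping the two bases
  independent lets one formula serve twice: for \<open>c = b\<close> it is the matrix-vector
  product, and for \<open>P\<close> the identity it is the change of coordinates.\<close>

lemma coord_endo: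
  assumes b: "indexed_basis r S b" and c: "indexed_basis r S c" and P: "endo_on S P" and x: "x \<in> S"
  shows "coord r b (P x) i = (\<Sum>k<r. coord r b (P (c k)) i * coord r c x k)"
proof -
  have S: "subspace S"
    by (rule indexed_basis_subspace[OF b])
  have PS: "P (c k) \<in> S" if "k < r" for k
    using P indexed_basis_in[OF c that] by (simp add: endo_on_def)
  have "P x = P (\<Sum>k<r. scale (coord r c x k) (c k))"
    by (simp only: coord_expand[OF c x])
  also have "\<dots> = (\<Sum>k<r. scale (coord r c x k) (P (c k)))"
    by (rule endo_on_sum[OF P S]) (auto intro: indexed_basis_in[OF c])
  finally have "coord r b (P x) i = (\<Sum>k<r. coord r b (scale (coord r c x k) (P (c k))) i)"
    using coord_sum[OF b, of "{..<r}" "\<lambda>k. scale (coord r c x k) (P (c k))"] PS S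
    by (simp add: subspace_scale)
  also have "\<dots> = (\<Sum>k<r. coord r b (P (c k)) i * coord r c x k)"
    by (intro sum.cong refl) (simp add: coord_scale[OF b PS] mult.commute)
  finally show ?thesis .
qed

text \<open>With \<open>X\<close> the transition matrix to the eigenbasis, the eigenvector equations
  read \<open>M * X = X * \<Delta>\<close>. Since \<open>Y\<close> inverts \<open>X\<close>, this is
  \<open>M = X * \<Delta> * Y\<close>.\<close>

lemma similar_mat_eigenbasis:
  assumes b: "indexed_basis r S b" and c: "indexed_basis r S c" and P: "endo_on S P"
    and len: "length ds = r" and ev: "\<And>j. j < r \<Longrightarrow> P (c j) = scale (ds ! j) (c j)"
  shows "similar_mat (matrix_of r b P) (diag_of_list ds)"
proof -
  define X where "X = Matrix.mat r r (\<lambda>(i, j). coord r b (c j) i)"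
  define Y where "Y = Matrix.mat r r (\<lambda>(i, j). coord r c (b j) i)"
  define M where "M = matrix_of r b P"
  define \<Delta> where "\<Delta> = diag_of_list ds"
  have car [simp]: "X \<in> carrier_mat r r" "Y \<in> carrier_mat r r" "M \<in> carrier_mat r r"
      "\<Delta> \<in> carrier_mat r r"
    by (auto simp: X_def Y_def M_def \<Delta>_def matrix_of_def diag_of_list_def len)
  have id: "endo_on S (\<lambda>x. x)"
    by (simp add: endo_on_def)
  \<comment> \<open>Translating \<open>b j\<close> into \<open>c\<close>-coordinates and back is
    \<open>coord_endo\<close> for the identity map, so the product has the unit vectors as
    columns.\<close>
  have XY: "X * Y = 1\<^sub>m r"
  proof (rule eq_matI)
    fix i j assume "i < dim_row (1\<^sub>m r)" "j < dim_col (1\<^sub>m r)"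
    then have ij: "i < r" "j < r" by auto
    show "(X * Y) $$ (i, j) = 1\<^sub>m r $$ (i, j)"
      using coord_endo[OF b c id indexed_basis_in[OF b ij(2)], of i] coord_basis[OF b ij] ij
      by (simp add: X_def Y_def scalar_prod_def lessThan_atLeast0)
  qed (auto simp: X_def Y_def)
  have YX: "Y * X = 1\<^sub>m r"
  proof (rule eq_matI)
    fix i j assume "i < dim_row (1\<^sub>m r)" "j < dim_col (1\<^sub>m r)"
    then have ij: "i < r" "j < r" by auto
    show "(Y * X) $$ (i, j) = 1\<^sub>m r $$ (i, j)"
      using coord_endo[OF c b id indexed_basis_in[OF c ij(2)], of i] coord_basis[OF c ij] ij
      by (simp add: X_def Y_def scalar_prod_def lessThan_atLeast0)
  qed (auto simp: X_def Y_def)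
  have MX: "M * X = X * \<Delta>"
  proof (rule eq_matI)
    fix i j assume "i < dim_row (X * \<Delta>)" "j < dim_col (X * \<Delta>)"
    then have ij: "i < r" "j < r" using car by (auto simp: X_def)
    have "(M * X) $$ (i, j) = coord r b (P (c j)) i"
      using coord_endo[OF b b P indexed_basis_in[OF c ij(2)], of i] ij
      by (simp add: X_def M_def matrix_of_def scalar_prod_def lessThan_atLeast0)
    also have "\<dots> = ds ! j * coord r b (c j) i"
      using ev ij coord_scale[OF b indexed_basis_in[OF c ij(2)]] by simp
    also have "\<dots> = (X * \<Delta>) $$ (i, j)"
      unfolding \<Delta>_def diag_of_list_def len using ij
      by (subst mat_diag_mult_right[of _ r r]) (auto simp: X_def)
    finally show "(M * X) $$ (i, j) = (X * \<Delta>) $$ (i, j)" .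
  qed (use carrier_matD[OF car(4)] in \<open>auto simp: X_def M_def matrix_of_def\<close>)
  have "X * \<Delta> * Y = M * X * Y"
    by (simp add: MX)
  also have "\<dots> = M * (X * Y)"
    by (rule assoc_mult_mat) (rule car)+
  also have "\<dots> = M"
    unfolding XY by (rule right_mult_one_mat) (rule car)
  finally have "M = X * \<Delta> * Y" ..
  then have "similar_mat_wit M \<Delta> X Y"
    by (intro similar_mat_witI[of _ _ r] XY YX car)
  then show ?thesis
    unfolding similar_mat_def M_def \<Delta>_def by blast
qed

lemma finite_basis_indexed:
  assumes "finite B" "independent B"
  obtains b where "indexed_basis (card B) (span B) b"
proof -
  obtain b where "bij_betw b {..<card B} B"
    using ex_bij_betw_nat_finite[OF assms(1)] unfolding lessThan_atLeast0 by blast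
  then have "indexed_basis (card B) (span B) b"
    using assms(2) by (simp add: indexed_basis_def bij_betw_def)
  then show ?thesis
    by (rule that)
qed

lemma indexed_basis_nth:
  assumes "distinct us" "independent (set us)"
  shows "indexed_basis (length us) (span (set us)) ((!) us)"
proof -
  have "(!) us ` {..<length us} = set us"
    by (auto simp: set_conv_nth)
  then show ?thesis
    using assms by (simp add: indexed_basis_def inj_on_nth)
qed

text \<open>Over the complex numbers the characteristic polynomial has a root, because its degree is
  the dimension, which is positive here. An eigenvector of the matrix is then read as the
  coordinates of a vector in \<open>S\<close>.\<close>

lemma eigenvector_exists:
  assumes B: "finite B" "independent B" "span B = S" and "S \<noteq> {0}" and P: "endo_on S P"
  shows "\<exists>u\<in>S. \<exists>a. u \<noteq> 0 \<and> P u = scale a u"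
proof -
  define r where "r = card B"
  obtain b where b: "indexed_basis r S b"
    using finite_basis_indexed[OF B(1,2)] B(3) r_def by blast
  have S: "subspace S"
    by (rule indexed_basis_subspace[OF b])
  have "r \<noteq> 0"
    using B \<open>S \<noteq> {0}\<close> by (auto simp: r_def)
  define M where "M = matrix_of r b P"
  have M: "M \<in> carrier_mat r r"
    by (simp add: M_def matrix_of_def)
  have "degree (char_poly M) = r"
    using degree_monic_char_poly[OF M] by simp
  then have "\<not> constant (poly (char_poly M))"
    using \<open>r \<noteq> 0\<close> by (simp add: constant_degree)
  then obtain a where "poly (char_poly M) a = 0"
    using fundamental_theorem_of_algebra by blast
  then obtain v where v: "v \<in> carrier_vec r" "v \<noteq> 0\<^sub>v r" "M *\<^sub>v v = a \<cdot>\<^sub>v v"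
    using eigenvalue_root_char_poly[OF M] M unfolding eigenvalue_def eigenvector_def by auto
  define u where "u = (\<Sum>j<r. scale (vec_index v j) (b j))"
  have uS: "u \<in> S"
    unfolding u_def by (intro subspace_sum subspace_scale S) (auto intro: indexed_basis_in[OF b])
  have cu: "coord r b u i = vec_index v i" if "i < r" for i
  proof -
    have "coord r b u i = (\<Sum>j<r. coord r b (scale (vec_index v j) (b j)) i)"
      unfolding u_def by (rule coord_sum[OF b]) (auto intro: subspace_scale[OF S] indexed_basis_in[OF b])
    also have "\<dots> = (\<Sum>j<r. if j = i then vec_index v i else 0)"
      using that by (intro sum.cong refl) (auto simp: coord_scale[OF b] indexed_basis_in[OF b] coord_basis[OF b])
    finally show ?thesis using that by simp
  qed
  have "u \<noteq> 0"
  proof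
    assume "u = 0"
    then have "coord r b u i = 0" for i
      using coord_scale[OF b uS, of 0 i] by simp
    then have "v = 0\<^sub>v r"
      using v(1) cu by (intro eq_vecI) auto
    with v(2) show False by simp
  qed
  moreover have "P u = scale a u"
  proof -
    have PuS: "P u \<in> S"
      using P uS by (simp add: endo_on_def)
    have "coord r b (P u) i = coord r b (scale a u) i" if i: "i < r" for i
    proof -
      have "coord r b (P u) i = (\<Sum>k<r. coord r b (P (b k)) i * vec_index v k)"
        using coord_endo[OF b b P uS, of i] by (simp add: cu)
      also have "\<dots> = vec_index (M *\<^sub>v v) i"
        using i v(1) by (simp add: M_def matrix_of_def scalar_prod_def lessThan_atLeast0)
      also have "\<dots> = coord r b (scale a u) i"
        using i v by (simp add: coord_scale[OF b uS] cu)
      finally show ?thesis .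
    qed
    then show ?thesis
      using coord_expand[OF b PuS] coord_expand[OF b subspace_scale[OF S uS, of a]]
      by (metis (no_types, lifting) lessThan_iff sum.cong)
  qed
  ultimately show ?thesis using uS by blast
qed

end

section \<open>Positive definite Hermitian forms, adjoints and orthogonal splitting\<close>

locale hermitian_space = complex_vector_space scale
  for scale :: "complex \<Rightarrow> 'v :: ab_group_add \<Rightarrow> 'v" +
  fixes V :: "'v set" and h :: "'v \<Rightarrow> 'v \<Rightarrow> complex"
  assumes V: "subspace V"
    and V_finite: "\<exists>B. finite B \<and> span B = V"
    and h_add: "u \<in> V \<Longrightarrow> u' \<in> V \<Longrightarrow> w \<in> V \<Longrightarrow> h (u + u') w = h u w + h u' w"
    and h_scale: "u \<in> V \<Longrightarrow> w \<in> V \<Longrightarrow> h (scale a u) w = a * h u w"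
    and h_sym: "u \<in> V \<Longrightarrow> w \<in> V \<Longrightarrow> h w u = cnj (h u w)"
    and h_pos: "u \<in> V \<Longrightarrow> u \<noteq> 0 \<Longrightarrow> 0 < Re (h u u)"
begin

lemma h_add_right:
  assumes "u \<in> V" "w \<in> V" "w' \<in> V"
  shows "h u (w + w') = h u w + h u w'"
  using assms h_sym[of "w + w'" u] h_sym[of w u] h_sym[of w' u] h_add subspace_add[OF V] by simp

lemma h_scale_right:
  assumes "u \<in> V" "w \<in> V"
  shows "h u (scale a w) = cnj a * h u w"
  using assms h_sym[of "scale a w" u] h_sym[of w u] h_scale subspace_scale[OF V] by simp

lemma h_minus_right: "u \<in> V \<Longrightarrow> w \<in> V \<Longrightarrow> h u (- w) = - h u w"
  using h_scale_right[of u w "- 1"] by simp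

lemma h_diff:
  assumes "u \<in> V" "u' \<in> V" "w \<in> V"
  shows "h (u - u') w = h u w - h u' w"
  using h_add[of "u - u'" u' w] assms subspace_diff[OF V] by simp

lemma h_diff_right:
  assumes "u \<in> V" "w \<in> V" "w' \<in> V"
  shows "h u (w - w') = h u w - h u w'"
  using h_add_right[of u "w - w'" w'] assms subspace_diff[OF V] by simp

lemma h_zero: "w \<in> V \<Longrightarrow> h 0 w = 0"
  using h_diff[of w w w] by simp

lemma h_self_nonzero: "u \<in> V \<Longrightarrow> u \<noteq> 0 \<Longrightarrow> h u u \<noteq> 0"
  using h_pos by fastforce

text \<open>Nondegeneracy follows from positivity by testing on \<open>u = w - w'\<close>. It makes
  adjoints unique and later turns equalities of forms into operator identities.\<close>

lemma h_eq_rightD: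
  assumes "w \<in> V" "w' \<in> V" "\<And>u. u \<in> V \<Longrightarrow> h u w = h u w'"
  shows "w = w'"
proof (rule ccontr)
  assume "w \<noteq> w'"
  moreover have "h (w - w') (w - w') = 0"
    using assms by (simp add: h_diff_right subspace_diff[OF V])
  ultimately show False
    using h_self_nonzero[of "w - w'"] assms subspace_diff[OF V] by auto
qed

lemma subspace_perp:
  assumes "w \<in> V"
  shows "subspace {x \<in> V. h x w = 0}"
  using assms by (auto simp: subspace_def h_zero h_add h_scale
      intro: subspace_0[OF V] subspace_add[OF V] subspace_scale[OF V])

text \<open>Gram-Schmidt as an induction on the spanning set: the new generator is made orthogonal
  to the old span, and the old representing vector is corrected by a multiple of the remainder. The
  functional stays arbitrary because the induction hypothesis is applied to two different
  functionals.\<close>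

lemma riesz_representation:
  assumes "finite B" "B \<subseteq> V"
    and "\<And>u v. u \<in> span B \<Longrightarrow> v \<in> span B \<Longrightarrow> \<phi> (u + v) = \<phi> u + \<phi> v"
    and "\<And>a u. u \<in> span B \<Longrightarrow> \<phi> (scale a u) = a * \<phi> u"
  shows "\<exists>w\<in>span B. \<forall>u\<in>span B. \<phi> u = h u w"
  using assms
proof (induction B arbitrary: \<phi> rule: finite_induct)
  case empty
  then have "\<phi> (scale 0 0) = 0 * \<phi> 0"
    by (metis span_zero)
  then show ?case
    by (auto simp: h_zero[OF subspace_0[OF V]])
next
  case (insert x B)
  have BV: "span B \<subseteq> V" and xV: "x \<in> V"
    using insert.prems(1) span_minimal[OF _ V] by auto
  have sub: "span B \<subseteq> span (insert x B)"
    by (rule span_mono) auto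
  have "\<exists>w\<in>span B. \<forall>u\<in>span B. \<phi> u = h u w"
    by (rule insert.IH) (use insert.prems sub in blast)+
  then obtain w1 where w1: "w1 \<in> span B" "\<And>u. u \<in> span B \<Longrightarrow> \<phi> u = h u w1"
    by blast
  \<comment> \<open>The vector representing the functional \<open>h u x\<close> of \<open>u\<close>
    on \<open>span B\<close> is the orthogonal projection of \<open>x\<close>.\<close>
  have "\<exists>w\<in>span B. \<forall>u\<in>span B. h u x = h u w"
    using insert.prems(1) BV xV by (intro insert.IH) (auto simp: h_add h_scale subset_iff)
  then obtain w2 where w2: "w2 \<in> span B" "\<And>u. u \<in> span B \<Longrightarrow> h u x = h u w2"
    by blast
  define y where "y = x - w2"
  have y: "y \<in> span (insert x B)"
    unfolding y_def using w2(1) sub by (intro span_diff) (auto intro: span_base)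
  have yV: "y \<in> V"
    using xV BV w2(1) by (auto simp: y_def intro!: subspace_diff[OF V])
  have perp: "h u y = 0" if "u \<in> span B" for u
    using that BV xV w2 by (auto simp: y_def h_diff_right subset_iff)
  have perp': "h y u = 0" if "u \<in> span B" for u
    using perp[OF that] h_sym[of u y] yV BV that by auto
  \<comment> \<open>The remainder \<open>y\<close> can replace \<open>x\<close> as a generator; in
    particular, if \<open>y = 0\<close> the span has not grown and \<open>w1\<close> already
    works.\<close>
  have split: "\<exists>v k. v \<in> span B \<and> u = v + scale k y" if "u \<in> span (insert x B)" for u
  proof -
    obtain k where k: "u - scale k x \<in> span B"
      using \<open>u \<in> span (insert x B)\<close> unfolding span_breakdown_eq by blast
    have "u - scale k x + scale k w2 \<in> span B"
      by (intro span_add span_scale k w2)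
    moreover have "u = (u - scale k x + scale k w2) + scale k y"
      by (simp add: y_def scale_right_diff_distrib)
    ultimately show ?thesis by blast
  qed
  show ?case
  proof (cases "y = 0")
    case True
    then have "span (insert x B) \<subseteq> span B"
      using split by fastforce
    then show ?thesis
      using w1 sub by blast
  next
    case False
    then have hy: "h y y \<noteq> 0"
      by (rule h_self_nonzero[OF yV])
    \<comment> \<open>The conjugate compensates for antilinearity in the second slot:
      \<open>h y (scale c y) = cnj c * h y y = \<phi> y\<close>.\<close>
    define c where "c = cnj (\<phi> y / h y y)"
    define w where "w = w1 + scale c y"
    have "\<phi> u = h u w" if u: "u \<in> span (insert x B)" for u
    proof -
      obtain v k where v: "v \<in> span B" and u_eq: "u = v + scale k y"
        using split[OF u] by blast
      have inV: "v \<in> V" "w1 \<in> V" "scale c y \<in> V" "scale k y \<in> V" "w \<in> V"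
        using v w1 BV yV by (auto simp: w_def intro!: subspace_scale[OF V] subspace_add[OF V])
      have "\<phi> u = h v w1 + k * \<phi> y"
        using insert.prems(2)[of v "scale k y"] insert.prems(3)[OF y, of k] v sub y w1(2)[OF v]
        by (auto simp: u_eq span_scale)
      moreover have "h v w = h v w1"
        using inV yV perp[OF v] by (simp add: w_def h_add_right h_scale_right)
      moreover have "h y w = \<phi> y"
        using inV yV perp'[OF w1(1)] hy by (simp add: w_def h_add_right h_scale_right c_def)
      ultimately show ?thesis
        using inV yV by (simp add: u_eq h_add h_scale)
    qed
    moreover have "w \<in> span (insert x B)"
      using w1(1) sub y by (auto simp: w_def intro!: span_add span_scale)
    ultimately show ?thesis by blast
  qed
qed

lemma adjoint_exists:
  assumes P: "endo_on V P" and w: "w \<in> V"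
  shows "\<exists>w'\<in>V. \<forall>u\<in>V. h (P u) w = h u w'"
proof -
  obtain B where B: "finite B" "span B = V"
    using V_finite by blast
  then have "B \<subseteq> V"
    using span_superset by blast
  with B P w show ?thesis
    using riesz_representation[of B "\<lambda>u. h (P u) w"] by (simp add: endo_on_def h_add h_scale)
qed

text \<open>\<open>form_adjoint\<close> is a definite description, so its characteristic property
  becomes available only from existence (Riesz) together with uniqueness (nondegeneracy).\<close>

lemma form_adjoint_h:
  assumes P: "endo_on V P" and u: "u \<in> V" and w: "w \<in> V"
  shows "h (P u) w = h u (form_adjoint V h P w)"
proof -
  have "\<exists>!w'. w' \<in> V \<and> (\<forall>u\<in>V. h (P u) w = h u w')"
    using adjoint_exists[OF P w] h_eq_rightD by (metis (no_types, lifting))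
  from theI'[OF this] show ?thesis
    using u unfolding form_adjoint_def by blast
qed

text \<open>The adjoint of \<open>P\<close> for \<open>g(x, y) = h(x, \<kappa> y)\<close> exists and equals \<open>\<kappa> P\<^sup>\<dagger> \<kappa>\<close>.\<close>

lemma form_adjoint_g:
  assumes P: "endo_on V P" and u: "u \<in> V" and w: "w \<in> V"
    and \<kappa>_closed: "\<And>x. x \<in> V \<Longrightarrow> \<kappa> x \<in> V" and \<kappa>_invol: "\<And>x. x \<in> V \<Longrightarrow> \<kappa> (\<kappa> x) = x"
  shows "h (P u) (\<kappa> w) = h u (\<kappa> (form_adjoint V (\<lambda>x y. h x (\<kappa> y)) P w))"
proof -
  obtain w' where w': "w' \<in> V" "\<forall>u\<in>V. h (P u) (\<kappa> w) = h u w'"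
    using adjoint_exists[OF P \<kappa>_closed[OF w]] by blast
  have "\<exists>!w'. w' \<in> V \<and> (\<forall>u\<in>V. h (P u) (\<kappa> w) = h u (\<kappa> w'))"
  proof (rule ex1I[of _ "\<kappa> w'"])
    show "\<kappa> w' \<in> V \<and> (\<forall>u\<in>V. h (P u) (\<kappa> w) = h u (\<kappa> (\<kappa> w')))"
      using w' by (simp add: \<kappa>_closed \<kappa>_invol)
    fix x assume x: "x \<in> V \<and> (\<forall>u\<in>V. h (P u) (\<kappa> w) = h u (\<kappa> x))"
    then have "\<kappa> x = w'"
      using w' by (intro h_eq_rightD) (auto simp: \<kappa>_closed)
    then show "x = \<kappa> w'"
      using x \<kappa>_invol by metis
  qed
  from theI'[OF this]
  show "h (P u) (\<kappa> w) = h u (\<kappa> (form_adjoint V (\<lambda>x y. h x (\<kappa> y)) P w))"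
    using u unfolding form_adjoint_def by blast
qed

lemma subspace_basis:
  assumes "subspace T" "T \<subseteq> V"
  obtains B where "finite B" "independent B" "span B = T"
proof -
  obtain B where B: "B \<subseteq> T" "independent B" "T \<subseteq> span B"
    using maximal_independent_subset by blast
  obtain C where C: "finite C" "span C = V"
    using V_finite by blast
  have "finite B"
    using independent_span_bound[OF C(1) B(2)] B(1) C(2) assms(2) by auto
  moreover have "span B = T"
    by (rule span_subspace[OF B(1,3) assms(1)])
  ultimately show ?thesis
    using B(2) that by blast
qed

text \<open>\<open>T\<close> is the orthogonal sum of the plane through \<open>u\<close> and
  \<open>v\<close> and the complement spanned by \<open>B\<close>. The non-membership claims serve
  to count the dimension and to keep lists of basis vectors distinct.\<close>

lemma insert_orthogonal_pair_basis:
  assumes T: "subspace T" "T \<subseteq> V" and u: "u \<in> T" "u \<noteq> 0" and v: "v \<in> T" "v \<noteq> 0"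
    and uv: "h u v = 0"
    and B: "independent B" "span B = {x \<in> T. h x u = 0 \<and> h x v = 0}"
  shows "u \<notin> B" "v \<notin> B" "u \<noteq> v"
    and "independent (insert u (insert v B))" "span (insert u (insert v B)) = T"
proof -
  have inV: "u \<in> V" "v \<in> V"
    using u v T by auto
  have huu: "h u u \<noteq> 0" and hvv: "h v v \<noteq> 0"
    using h_self_nonzero inV u v by auto
  have vu: "h v u = 0"
    using h_sym[OF inV] uv by simp
  have v_span: "v \<notin> span B"
    using B(2) hvv by simp
  have "B \<subseteq> span B"
    by (rule span_superset)
  \<comment> \<open>\<open>v\<close> and \<open>B\<close> lie in the orthogonal complement of
    \<open>u\<close>, which is a subspace and does not contain \<open>u\<close> itself.\<close>
  then have "insert v B \<subseteq> {x \<in> V. h x u = 0}"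
    using B(2) T(2) vu inV by auto
  then have "span (insert v B) \<subseteq> {x \<in> V. h x u = 0}"
    by (rule span_minimal[OF _ subspace_perp[OF inV(1)]])
  then have u_span: "u \<notin> span (insert v B)"
    using huu by auto
  show "u \<notin> B" "v \<notin> B" "u \<noteq> v"
    using u_span v_span span_base by auto
  show "independent (insert u (insert v B))"
    by (intro independent_insertI u_span v_span B(1))
  show "span (insert u (insert v B)) = T"
  proof (rule antisym)
    show "span (insert u (insert v B)) \<subseteq> T"
      using u v B(2) \<open>B \<subseteq> span B\<close> by (intro span_minimal T(1)) auto
    show "T \<subseteq> span (insert u (insert v B))"
    proof
      fix x assume x: "x \<in> T"
      \<comment> \<open>These are the coefficients of the orthogonal projection onto the plane; as
        \<open>u\<close> and \<open>v\<close> are orthogonal, subtracting one component does not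
        disturb the other inner product.\<close>
      define k where "k = h x u / h u u"
      define m where "m = h x v / h v v"
      have xV: "x \<in> V" and su: "scale k u \<in> V" and sv: "scale m v \<in> V"
        using x inV T(2) by (auto intro: subspace_scale[OF V])
      have "x - scale k u - scale m v \<in> T"
        using x u v by (intro subspace_diff subspace_scale T(1))
      moreover have "h (x - scale k u - scale m v) u = 0" "h (x - scale k u - scale m v) v = 0"
        using xV su sv inV huu hvv uv vu
        by (auto simp: h_diff h_scale subspace_diff[OF V] k_def m_def)
      ultimately have "x - scale k u - scale m v \<in> span B"
        using B(2) by simp
      then show "x \<in> span (insert u (insert v B))"
        unfolding span_breakdown_eq by blast
    qed
  qed
qed

end

section \<open>Self-adjoint operators that anticommute with a real structure\<close>

locale skew_real_hermitian_space = hermitian_space scale V h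
  for scale :: "complex \<Rightarrow> 'v :: ab_group_add \<Rightarrow> 'v" and V h +
  fixes \<kappa> Q :: "'v \<Rightarrow> 'v"
  assumes Q_endo: "endo_on V Q"
    and Q_selfadjoint: "u \<in> V \<Longrightarrow> w \<in> V \<Longrightarrow> h (Q u) w = h u (Q w)"
    and \<kappa>_closed: "u \<in> V \<Longrightarrow> \<kappa> u \<in> V"
    and \<kappa>_scale: "u \<in> V \<Longrightarrow> \<kappa> (scale a u) = scale (cnj a) (\<kappa> u)"
    and \<kappa>_invol: "u \<in> V \<Longrightarrow> \<kappa> (\<kappa> u) = u"
    and \<kappa>_h: "u \<in> V \<Longrightarrow> w \<in> V \<Longrightarrow> h (\<kappa> u) (\<kappa> w) = cnj (h u w)"
    and Q_\<kappa>: "u \<in> V \<Longrightarrow> Q (\<kappa> u) = - \<kappa> (Q u)"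
begin

lemma Q_closed: "u \<in> V \<Longrightarrow> Q u \<in> V"
  using Q_endo by (simp add: endo_on_def)

lemma endo_on_subset: "T \<subseteq> V \<Longrightarrow> (\<And>x. x \<in> T \<Longrightarrow> Q x \<in> T) \<Longrightarrow> endo_on T Q"
  using Q_endo by (auto simp: endo_on_def subset_iff)

lemma eigenvalue_real:
  assumes "u \<in> V" "u \<noteq> 0" "Q u = scale a u"
  shows "cnj a = a"
proof -
  have "a * h u u = cnj a * h u u"
    using Q_selfadjoint[OF assms(1,1)] assms by (simp add: h_scale h_scale_right)
  then show ?thesis
    using h_self_nonzero[OF assms(1,2)] by simp
qed

text \<open>Anticommutation and antilinearity produce the eigenvalue \<open>- cnj a\<close>, and
  \<open>a\<close> is real. The vector does not vanish because \<open>\<kappa>\<close> preserves the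
  norm.\<close>

lemma eigenvector_conj:
  assumes "u \<in> V" "u \<noteq> 0" "Q u = scale a u"
  shows "\<kappa> u \<noteq> 0" "Q (\<kappa> u) = scale (- a) (\<kappa> u)"
proof -
  have "h (\<kappa> u) (\<kappa> u) \<noteq> 0"
    using \<kappa>_h[OF assms(1,1)] h_self_nonzero[OF assms(1,2)] by simp
  then show "\<kappa> u \<noteq> 0"
    using h_zero[OF subspace_0[OF V]] by auto
  show "Q (\<kappa> u) = scale (- a) (\<kappa> u)"
    using Q_\<kappa>[OF assms(1)] \<kappa>_scale[OF assms(1)] eigenvalue_real[OF assms] assms(3) by simp
qed

text \<open>The image of \<open>T\<close> under \<open>Q\<close> is invariant, so if it were nonzero
  it would contain an eigenvector \<open>u = Q y\<close>. Its eigenvalue is 0 by assumption, and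
  self-adjointness then gives \<open>h u u = h (Q u) y = 0\<close>, a contradiction.\<close>

lemma Q_zero_if_no_nonzero_eigenvalue:
  assumes T: "subspace T" "T \<subseteq> V" and QT: "\<And>x. x \<in> T \<Longrightarrow> Q x \<in> T"
    and ev: "\<And>u a. u \<in> T \<Longrightarrow> u \<noteq> 0 \<Longrightarrow> Q u = scale a u \<Longrightarrow> a = 0"
    and x: "x \<in> T"
  shows "Q x = 0"
proof -
  have E: "endo_on T Q"
    by (rule endo_on_subset[OF T(2) QT])
  have lin: "Q (u + v) = Q u + Q v" "Q (scale a u) = scale a (Q u)" if "u \<in> T" "v \<in> T" for a u v
    using E that by (auto simp: endo_on_def)
  have Q0: "Q 0 = 0"
    using lin(2)[OF subspace_0[OF T(1)] subspace_0[OF T(1)], of 0] by simp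
  have R: "subspace (Q ` T)"
    unfolding subspace_def
  proof (intro conjI ballI allI)
    show "0 \<in> Q ` T"
      using Q0 subspace_0[OF T(1)] by force
  next
    fix y z assume "y \<in> Q ` T" "z \<in> Q ` T"
    then show "y + z \<in> Q ` T"
      by (smt (verit) T(1) image_iff lin(1) subspace_add)
  next
    fix a y assume "y \<in> Q ` T"
    then show "scale a y \<in> Q ` T"
      by (smt (verit) T(1) image_iff lin(2) subspace_scale)
  qed
  have RT: "Q ` T \<subseteq> T"
    using QT by blast
  have "Q ` T = {0}"
  proof (rule ccontr)
    assume "Q ` T \<noteq> {0}"
    moreover obtain B where "finite B" "independent B" "span B = Q ` T"
      using subspace_basis[OF R order_trans[OF RT T(2)]] .
    moreover have "endo_on (Q ` T) Q"
      by (rule endo_on_subset[OF order_trans[OF RT T(2)]]) (use RT in blast)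
    ultimately obtain u a where u: "u \<in> Q ` T" "u \<noteq> 0" "Q u = scale a u"
      using eigenvector_exists[of _ "Q ` T" Q] by metis
    then obtain y where y: "y \<in> T" "u = Q y"
      by blast
    have "Q u = 0"
      using u ev[of u a] RT by auto
    have "h u u = h (Q u) y"
      using Q_selfadjoint[of u y] y u(1) RT T(2) by (metis subsetD)
    also have "\<dots> = 0"
      using \<open>Q u = 0\<close> h_zero y(1) T(2) by auto
    finally show False
      using h_self_nonzero[of u] u RT T(2) by auto
  qed
  then show ?thesis
    using x by blast
qed

text \<open>Strong induction over invariant subspaces. Splitting off a pair lowers the dimension by
  two, so the middle block of \<open>dim T mod 2\<close> zeros is untouched and both parities are
  handled at once.\<close>

lemma paired_eigenbasis:
  assumes "subspace T" "T \<subseteq> V" "\<And>x. x \<in> T \<Longrightarrow> Q x \<in> T" "\<And>x. x \<in> T \<Longrightarrow> \<kappa> x \<in> T"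
  shows "\<exists>ls us. length ls = dim T div 2 \<and> (\<forall>a\<in>set ls. 0 \<le> a) \<and>
    distinct us \<and> independent (set us) \<and> span (set us) = T \<and>
    list_all2 (\<lambda>u a. Q u = scale (complex_of_real a) u) us
      (ls @ replicate (dim T mod 2) 0 @ map uminus ls)"
  using assms
proof (induction "dim T" arbitrary: T rule: less_induct)
  case less
  note T = less.prems(1,2)
  note QT = less.prems(3)
  note \<kappa>T = less.prems(4)
  show ?case
  proof (cases "\<exists>u\<in>T. \<exists>a. u \<noteq> 0 \<and> a \<noteq> 0 \<and> Q u = scale a u")
    \<comment> \<open>Here \<open>Q\<close> vanishes on \<open>T\<close>, so any basis consists of
      eigenvectors and every entry of the list is 0.\<close>
    case False
    obtain B where B: "finite B" "independent B" "span B = T"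
      using subspace_basis[OF T] by blast
    obtain us where us: "set us = B" "distinct us"
      using finite_distinct_list[OF B(1)] by blast
    have "Q x = 0" if "x \<in> T" for x
      using Q_zero_if_no_nonzero_eigenvalue[OF T QT _ that] False by blast
    moreover have "set us \<subseteq> T"
      using B(3) us(1) span_superset by blast
    moreover have "length us = dim T"
      using us B dim_eq_card[of B T] distinct_card[OF us(2)] by (metis span_span)
    moreover have "replicate (dim T div 2) 0 @ replicate (dim T mod 2) 0 @
        map uminus (replicate (dim T div 2) 0) = replicate (dim T) (0 :: real)"
    proof -
      have "dim T div 2 + (dim T mod 2 + dim T div 2) = dim T"
        by presburger
      then show ?thesis
        by (simp add: replicate_add [symmetric])
    qed
    ultimately show ?thesis
      using us B
      by (intro exI[of _ "replicate (dim T div 2) 0"] exI[of _ us])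
        (auto simp: list_all2_conv_all_nth subset_iff)
  next
    case True
    then obtain u0 a0 where u0: "u0 \<in> T" "u0 \<noteq> 0" "a0 \<noteq> 0" "Q u0 = scale a0 u0"
      by blast
    \<comment> \<open>The eigenvalue can be taken positive: if \<open>a0\<close> is negative,
      \<open>\<kappa> u0\<close> has the eigenvalue \<open>- a0\<close>.\<close>
    obtain u a where u: "u \<in> T" "u \<noteq> 0" "0 < a" "Q u = scale (complex_of_real a) u"
    proof (cases "0 < Re a0")
      case True
      have "a0 = complex_of_real (Re a0)"
        using eigenvalue_real[of u0 a0] u0 T by (auto simp: complex_eq_iff)
      then show ?thesis
        using that[of u0 "Re a0"] True u0 by metis
    next
      case False
      have a0: "a0 = complex_of_real (Re a0)"
        using eigenvalue_real[of u0 a0] u0 T by (auto simp: complex_eq_iff)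
      then have "Re a0 < 0"
        using False u0(3) by (metis linorder_neqE_linordered_idom of_real_0)
      moreover have "- a0 = complex_of_real (- Re a0)"
        using a0 by simp
      ultimately show ?thesis
        using that[of "\<kappa> u0" "- Re a0"] eigenvector_conj[of u0 a0] u0 T \<kappa>T by auto
    qed
    define v where "v = \<kappa> u"
    have uV: "u \<in> V"
      using u(1) T(2) by blast
    have v: "v \<in> T" "v \<noteq> 0" "Q v = scale (complex_of_real (- a)) v" "\<kappa> v = u"
      using eigenvector_conj[OF uV u(2,4)] \<kappa>T u(1) \<kappa>_invol[OF uV] by (auto simp: v_def)
    have vV: "v \<in> V"
      using v(1) T(2) by blast
    \<comment> \<open>Eigenvectors for the distinct eigenvalues \<open>a\<close> and
      \<open>- a\<close> are orthogonal; this is self-adjointness evaluated on \<open>u\<close> and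
      \<open>v\<close>.\<close>
    have "complex_of_real a * h u v = - complex_of_real a * h u v"
      using Q_selfadjoint[OF uV vV] uV vV u(4) v(3) by (simp add: h_scale h_scale_right h_minus_right subspace_scale[OF V])
    then have uv: "h u v = 0"
      using u(3) by simp
    define T' where "T' = {x \<in> T. h x u = 0 \<and> h x v = 0}"
    have T': "subspace T'"
    proof -
      have "T' = T \<inter> {x \<in> V. h x u = 0} \<inter> {x \<in> V. h x v = 0}"
        using T(2) by (auto simp: T'_def)
      then show ?thesis
        by (simp add: subspace_inter T(1) subspace_perp uV vV)
    qed
    have T'V: "T' \<subseteq> V"
      using T(2) by (auto simp: T'_def)
    have QT': "Q x \<in> T'" if "x \<in> T'" for x
    proof -
      have x: "x \<in> T" "x \<in> V" "h x u = 0" "h x v = 0"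
        using that T(2) by (auto simp: T'_def)
      then show ?thesis
        using QT Q_selfadjoint uV vV u(4) v(3)
        by (simp add: T'_def h_scale_right h_minus_right subspace_scale[OF V])
    qed
    \<comment> \<open>Since \<open>\<kappa>\<close> swaps \<open>u\<close> and \<open>v\<close> and
      preserves \<open>h\<close> up to conjugation, it exchanges the two orthogonality
      conditions.\<close>
    have \<kappa>T': "\<kappa> x \<in> T'" if "x \<in> T'" for x
    proof -
      have x: "x \<in> T" "x \<in> V" "h x u = 0" "h x v = 0"
        using that T(2) by (auto simp: T'_def)
      then show ?thesis
        using \<kappa>T \<kappa>_h[of x v] \<kappa>_h[of x u] uV vV v(4) by (simp add: T'_def v_def)
    qed
    note pair = insert_orthogonal_pair_basis[OF T u(1,2) v(1,2) uv, folded T'_def]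
    obtain B where B: "finite B" "independent B" "span B = T'"
      using subspace_basis[OF T' T'V] by blast
    have "dim T = card (insert u (insert v B))"
      by (rule dim_eq_card) (use pair(4,5)[OF B(2,3)] in \<open>metis span_span\<close>)+
    also have "\<dots> = card B + 2"
      using pair(1-3)[OF B(2,3)] B(1) by simp
    also have "card B = dim T'"
      by (rule dim_eq_card [symmetric]) (use B in \<open>metis span_span\<close>)+
    finally have dim: "dim T = dim T' + 2" .
    then obtain ls us where IH: "length ls = dim T' div 2" "\<forall>a\<in>set ls. 0 \<le> a"
        "distinct us" "independent (set us)" "span (set us) = T'"
        "list_all2 (\<lambda>u a. Q u = scale (complex_of_real a) u) us
          (ls @ replicate (dim T' mod 2) 0 @ map uminus ls)"
      using less.hyps[OF _ T' T'V QT' \<kappa>T'] by auto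
    \<comment> \<open>The eigenvectors are cut into the same three blocks as the eigenvalues, so
      that \<open>u\<close> can head the first block and \<open>v\<close> the third.\<close>
    obtain xs ms ys where us: "us = xs @ ms @ ys"
        "list_all2 (\<lambda>u a. Q u = scale (complex_of_real a) u) xs ls"
        "list_all2 (\<lambda>u a. Q u = scale (complex_of_real a) u) ms (replicate (dim T' mod 2) 0)"
        "list_all2 (\<lambda>u a. Q u = scale (complex_of_real a) u) ys (map uminus ls)"
      using IH(6) unfolding list_all2_append2 by blast
    define us' where "us' = (u # xs) @ ms @ (v # ys)"
    have set': "set us' = insert u (insert v (set us))"
      by (auto simp: us'_def us(1))
    have "distinct us'"
      using IH(3) pair(1-3)[OF IH(4,5)] by (auto simp: us'_def us(1))
    moreover have "independent (set us')" "span (set us') = T"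
      unfolding set' by (rule pair(4,5)[OF IH(4,5)])+
    moreover have "list_all2 (\<lambda>u a. Q u = scale (complex_of_real a) u) us'
        ((a # ls) @ replicate (dim T mod 2) 0 @ map uminus (a # ls))"
      unfolding us'_def using us u(4) v(3) dim
      by (intro list_all2_appendI) simp_all
    moreover have "length (a # ls) = dim T div 2" "\<forall>x\<in>set (a # ls). 0 \<le> x"
      using IH(1,2) dim u(3) by auto
    ultimately show ?thesis
      by blast
  qed
qed

text \<open>The eigenbasis \<open>c\<close> is returned along with the list because odd rank
  requires an explicit vector in the kernel.\<close>

lemma similar_mat_paired_diag:
  assumes "dim V = r"
  obtains ls :: "real list" and c where
    "length ls = r div 2" "\<forall>a\<in>set ls. 0 \<le> a" "indexed_basis r V c"
    "\<And>j. j < r \<Longrightarrow> Q (c j) =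
      scale (map complex_of_real (ls @ replicate (r mod 2) 0 @ map uminus ls) ! j) (c j)"
    "\<And>b. indexed_basis r V b \<Longrightarrow> similar_mat (matrix_of r b Q)
      (diag_of_list (map complex_of_real (ls @ replicate (r mod 2) 0 @ map uminus ls)))"
proof -
  obtain ls us where len: "length ls = r div 2" and nonneg: "\<forall>a\<in>set ls. 0 \<le> a"
    and us: "distinct us" "independent (set us)" "span (set us) = V"
    and ev: "list_all2 (\<lambda>u a. Q u = scale (complex_of_real a) u) us
      (ls @ replicate (r mod 2) 0 @ map uminus ls)"
    using paired_eigenbasis[OF V subset_refl Q_closed \<kappa>_closed] assms by auto
  define ds where "ds = map complex_of_real (ls @ replicate (r mod 2) 0 @ map uminus ls)"
  have len_ds: "length ds = r"
    unfolding ds_def using len by simp presburger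
  have len_us: "length us = r"
    using list_all2_lengthD[OF ev] len_ds by (simp add: ds_def)
  then have c: "indexed_basis r V ((!) us)"
    using indexed_basis_nth[OF us(1,2)] us(3) by simp
  have ev': "Q (us ! j) = scale (ds ! j) (us ! j)" if "j < r" for j
    using list_all2_nthD[OF ev, of j] that len_us len_ds unfolding ds_def
    by (simp only: nth_map length_map)
  have "similar_mat (matrix_of r b Q) (diag_of_list ds)" if "indexed_basis r V b" for b
    by (rule similar_mat_eigenbasis[OF that c Q_endo len_ds ev'])
  with len nonneg c ev' show ?thesis
    unfolding ds_def by (rule that)
qed

end

section \<open>Passage to the fibre of a tt*-bundle, and the diagonal form\<close>

lemma (in tt_star_bundle) skew_real_hermitian_space_fibre:
  "skew_real_hermitian_space scale (E p) (h p) (\<kappa> p) (\<Q> p)"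
  and dim_fibre: "dim (E p) = r"
proof -
  obtain U e where e: "(U, e) \<in> F" "p \<in> U"
    using frame_cover[of p] by blast
  have b: "indexed_basis r (E p) (\<lambda>j. e j p)"
    by (rule frame_basis[OF e])
  let ?B = "(\<lambda>j. e j p) ` {..<r}"
  have B: "independent ?B" "span ?B = E p" "card ?B = r"
    using b by (auto simp: indexed_basis_def card_image)
  have V: "subspace (E p)"
    by (rule indexed_basis_subspace[OF b])
  show "dim (E p) = r"
    using dim_eq_card[of ?B "E p"] B by (metis span_span)
  interpret H: hermitian_space scale "E p" "h p"
    by unfold_locales (use V B(2) h_add h_scale h_sym h_pos in \<open>blast+\<close>)
  have Q: "endo_on (E p) (\<Q> p)"
    using Q_smooth by (simp add: smooth_endo_def)
  have sa: "h p (\<Q> p u) w = h p u (\<Q> p w)" if "u \<in> E p" "w \<in> E p" for u w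
    using H.form_adjoint_h[OF Q that] Q_selfadjoint[OF that(2)] by (simp add: hadj_def)
  \<comment> \<open>The number \<open>h p (\<Q> p u) (\<kappa> p w)\<close> is computed twice: by
    self-adjointness for \<open>h\<close>, and by skewness for the bilinear form built from
    \<open>h\<close> and \<open>\<kappa>\<close>. Nondegeneracy then compares the second
    arguments.\<close>
  have "\<Q> p (\<kappa> p w) = - \<kappa> p (\<Q> p w)" if w: "w \<in> E p" for w
  proof (rule H.h_eq_rightD)
    have Qw: "\<Q> p w \<in> E p" "\<Q> p (\<kappa> p w) \<in> E p"
      using Q w kappa_closed by (auto simp: endo_on_def)
    then show "\<Q> p (\<kappa> p w) \<in> E p" "- \<kappa> p (\<Q> p w) \<in> E p"
      using kappa_closed by (auto intro: subspace_neg[OF V])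
    fix u assume u: "u \<in> E p"
    have "h p (\<Q> p u) (\<kappa> p w) =
        h p u (\<kappa> p (form_adjoint (E p) (\<lambda>x y. h p x (\<kappa> p y)) (\<Q> p) w))"
      by (rule H.form_adjoint_g[OF Q u w kappa_closed kappa_invol])
    \<comment> \<open>The sign is written as the scalar \<open>- 1\<close> so that
      \<open>kappa_scale\<close> can move it out; being real, it survives conjugation.\<close>
    also have "form_adjoint (E p) (\<lambda>x y. h p x (\<kappa> p y)) (\<Q> p) w = (- 1) \<odot> \<Q> p w"
      using Q_g_skew[OF w] by (simp add: eq_neg_iff_add_eq_0)
    also have "\<kappa> p ((- 1) \<odot> \<Q> p w) = - \<kappa> p (\<Q> p w)"
      using kappa_scale[OF Qw(1), of "- 1"] by simp
    finally show "h p u (\<Q> p (\<kappa> p w)) = h p u (- \<kappa> p (\<Q> p w))"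
      using sa[OF u kappa_closed[OF w]] by simp
  qed
  then show "skew_real_hermitian_space scale (E p) (h p) (\<kappa> p) (\<Q> p)"
    by unfold_locales
      (use Q sa kappa_closed kappa_scale kappa_invol kappa_h in \<open>blast+\<close>)
qed

text \<open>The list is chosen before the basis \<open>b\<close>: the eigenvalues belong to the
  operator, and another basis only conjugates its matrix.\<close>

theorem proposition3:
  fixes n r :: nat
    and A :: "('m :: {t2_space, second_countable_topology}) chart set"
    and scale :: "complex \<Rightarrow> 'v :: ab_group_add \<Rightarrow> 'v"
    and E :: "'m \<Rightarrow> 'v set"
    and F :: "('m set \<times> (nat \<Rightarrow> 'm \<Rightarrow> 'v)) set"
    and h :: "'m \<Rightarrow> 'v \<Rightarrow> 'v \<Rightarrow> complex"
    and D :: "'m \<Rightarrow> 'm tvec \<Rightarrow> ('m \<Rightarrow> 'v) \<Rightarrow> 'v"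
    and \<Phi> :: "'m \<Rightarrow> 'm tvec \<Rightarrow> 'v \<Rightarrow> 'v"
    and \<U> \<Q> \<kappa> :: "'m \<Rightarrow> 'v \<Rightarrow> 'v"
    and p :: 'm
  assumes "tt_star_bundle n A scale r E F h D \<Phi> \<U> \<Q> \<kappa>"
  shows "(\<forall>l. r = 2 * l + 1 \<longrightarrow>
            complex_vector_space.is_eigenvalue_on scale (E p) (\<Q> p) 0 \<and>
            (\<exists>ls :: real list. length ls = l \<and> (\<forall>a\<in>set ls. 0 \<le> a) \<and>
               (\<forall>b. complex_vector_space.indexed_basis scale r (E p) b \<longrightarrow>
                  similar_mat (complex_vector_space.matrix_of scale r b (\<Q> p))
                    (diag_of_list (map complex_of_real (ls @ [0] @ map uminus ls))))))
       \<and> (\<forall>l. r = 2 * l \<longrightarrow>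
            (\<exists>ls :: real list. length ls = l \<and> (\<forall>a\<in>set ls. 0 \<le> a) \<and>
               (\<forall>b. complex_vector_space.indexed_basis scale r (E p) b \<longrightarrow>
                  similar_mat (complex_vector_space.matrix_of scale r b (\<Q> p))
                    (diag_of_list (map complex_of_real (ls @ map uminus ls))))))"
proof -
  interpret tt_star_bundle n A scale r E F h D \<Phi> \<U> \<Q> \<kappa>
    by (rule assms)
  interpret Q: skew_real_hermitian_space scale "E p" "h p" "\<kappa> p" "\<Q> p"
    by (rule skew_real_hermitian_space_fibre)
  obtain ls :: "real list" and c where ls: "length ls = r div 2" "\<forall>a\<in>set ls. 0 \<le> a"
    and c: "indexed_basis r (E p) c"
    and ev: "\<And>j. j < r \<Longrightarrow> \<Q> p (c j) =
      scale (map complex_of_real (ls @ replicate (r mod 2) 0 @ map uminus ls) ! j) (c j)"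
    and sim: "\<And>b. indexed_basis r (E p) b \<Longrightarrow> similar_mat (matrix_of r b (\<Q> p))
      (diag_of_list (map complex_of_real (ls @ replicate (r mod 2) 0 @ map uminus ls)))"
    using Q.similar_mat_paired_diag[OF dim_fibre] by blast
  show ?thesis
  proof (intro conjI allI impI)
    fix l assume r: "r = 2 * l + 1"
    \<comment> \<open>The middle 0 stands at index \<open>l = length ls\<close>, so
      \<open>c l\<close> is the vector that exhibits the eigenvalue 0.\<close>
    have "c l \<noteq> 0"
    proof
      assume "c l = 0"
      then have "0 \<in> c ` {..<r}"
        using r imageI[of l "{..<r}" c] by simp
      then show False
        using c dependent_zero by (auto simp: indexed_basis_def)
    qed
    moreover have "\<Q> p (c l) = scale 0 (c l)"
      using ev[of l] ls(1) r by (simp add: nth_append)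
    ultimately show "is_eigenvalue_on (E p) (\<Q> p) 0"
      using indexed_basis_in[OF c, of l] r by (auto simp: is_eigenvalue_on_def)
    show "\<exists>ls :: real list. length ls = l \<and> (\<forall>a\<in>set ls. 0 \<le> a) \<and>
        (\<forall>b. indexed_basis r (E p) b \<longrightarrow> similar_mat (matrix_of r b (\<Q> p))
          (diag_of_list (map complex_of_real (ls @ [0] @ map uminus ls))))"
      using ls sim r by (intro exI[of _ ls]) simp
  next
    fix l assume r: "r = 2 * l"
    show "\<exists>ls :: real list. length ls = l \<and> (\<forall>a\<in>set ls. 0 \<le> a) \<and>
        (\<forall>b. indexed_basis r (E p) b \<longrightarrow> similar_mat (matrix_of r b (\<Q> p))
          (diag_of_list (map complex_of_real (ls @ map uminus ls))))"
      using ls sim r by (intro exI[of _ ls]) simp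
  qed
qed

end
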